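(* Suppose that $\lambda_1\ge\dots\ge\lambda_{\tilde d}$, $\lambda_d>0$ and $\lambda_d>\lambda_{d+1}$. Let $n\in\{1,\dots,\ell\}$, let $\gamma_n$ be the smallest root of $\pi_n$, and let $\sigma\in\mathbb{R}^{\tilde d-d}$ be the vector defined in the context (for this $n$). If $\|\sigma\|_1<1$, then the roots of $\tilde\pi_n$ are lower-bounded by $(1-\|\sigma\|_1)\gamma_n$. In particular, they are positive.
   Context: Let $\tilde d\ge d$ be positive integers, $\lambda_1,\dots,\lambda_{\tilde d}\in\mathbb{R}$ and $b_1,\dots,b_{\tilde d}\in\mathbb{R}$. Let $A=\mathrm{diag}(\lambda_1,\dots,\lambda_d)$ and $b=(b_1,\dots,b_d)^\top$. The grade $\ell$ of $(A,b)$ is the largest integer $n$ such that $\mathrm{span}\{b,Ab,\dots,A^{n-1}b\}$ has dimension $n$. $\mathcal{P}_{\le n}$ is the space of real univariate polynomials of degree at most $n$. On polynomials define $$\langle p,q\rangle=\sum_{i=1}^d b_i^2p(\lambda_i)q(\lambda_i),\qquad\langle p,q\rangle_\sim=\sum_{i=1}^{\tilde d}b_i^2p(\lambda_i)q(\lambda_i),$$ with induced semi-norms $\|\cdot\|$ and $\|\cdot\|_\sim$. For $n\le\ell$, $\pi_n$ (resp. $\tilde\pi_n$) is the unique minimizer of $\|\pi\|^2$ (resp. $\|\pi\|_\sim^2$) over $\pi\in\mathcal{P}_{\le n}$ whose coefficient of degree $n$ equals $1$; the roots of $\pi_n$ and of $\tilde\pi_n$ are real and distinct. For $d<j\le\tilde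 d$ and $0\le n<\ell$, $\zeta_n^j$ is the unique minimizer of $\|\zeta\|^2$ over $\zeta\in\mathcal{P}_{\le n}$ subject to $\zeta(\lambda_j)=1$. Under the stated assumptions on the $\lambda_i$, all roots of $\pi_n$ and $\zeta_n^j$ are real and positive; define $\varsigma_n=\pi_n/\pi_n(0)$ and $\xi_n^j=\zeta_n^j/\zeta_n^j(0)$. Definition of $\sigma$ (for a given $n\in\{1,\dots,\ell\}$; indices $i,j$ run over $\{d+1,\dots,\tilde d\}$): $B=\mathrm{diag}(b_{d+1},\dots,b_{\tilde d})$, $C_{ij}=\xi_{n-1}^j(\lambda_i)$, $D$ diagonal with $D_{jj}=\|\xi_{n-1}^j\|^2/\xi_{n-1}^j(\lambda_j)$, $w_i=\varsigma_n(\lambda_i)$, and $\sigma=(D+B^2C)^{-1}B^2w$ (the inverse exists). $\|\sigma\|_1=\sum_j|\sigma_j|$. *)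

theory Defs
  imports
    "HOL-Computational_Algebra.Polynomial"
    "Jordan_Normal_Form.DL_Rank"
    "Jordan_Normal_Form.Gauss_Jordan_Elimination"
begin

text \<open>
  The data are families \<open>lam, b :: nat \<Rightarrow> real\<close>, of which only the values at the indices
  \<open>1, \<dots>, dt\<close> are meaningful. Vectors and matrices are indexed from \<open>0\<close>, so entry \<open>i\<close> of a vector
  of dimension \<open>d\<close> belongs to the index \<open>i + 1\<close>, and entry \<open>i\<close> of a vector of dimension \<open>dt - d\<close>
  belongs to the index \<open>d + 1 + i\<close>.
\<close>

text \<open>The rank is by definition the dimension of the span of the columns
  \<open>b, A b, \<dots>, A\<^sup>n\<^sup>-\<^sup>1 b\<close>. It is at most \<open>d\<close>, so the greatest \<open>n\<close> exists.\<close>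

definition grade :: "nat \<Rightarrow> (nat \<Rightarrow> real) \<Rightarrow> (nat \<Rightarrow> real) \<Rightarrow> nat" where
  "grade d lam b =
    (let A = mat_diag d (\<lambda>i. lam (i + 1)); v = vec d (\<lambda>i. b (i + 1))
     in GREATEST n.
          vec_space.rank d (mat_of_cols d (map (\<lambda>k. (A ^\<^sub>m k) *\<^sub>v v) [0..<n])) = n)"

text \<open>The parameter \<open>m\<close> is \<open>d\<close> for the plain product and \<open>dt\<close> for the one with a tilde; likewise
  for the objects derived from it.\<close>

definition ip :: "nat \<Rightarrow> (nat \<Rightarrow> real) \<Rightarrow> (nat \<Rightarrow> real) \<Rightarrow> real poly \<Rightarrow> real poly \<Rightarrow> real" where
  "ip m lam b p q = (\<Sum>i=1..m. (b i)\<^sup>2 * poly p (lam i) * poly q (lam i))"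

definition pnorm :: "nat \<Rightarrow> (nat \<Rightarrow> real) \<Rightarrow> (nat \<Rightarrow> real) \<Rightarrow> real poly \<Rightarrow> real" where
  "pnorm m lam b p = sqrt (ip m lam b p p)"

definition pi_poly :: "nat \<Rightarrow> (nat \<Rightarrow> real) \<Rightarrow> (nat \<Rightarrow> real) \<Rightarrow> nat \<Rightarrow> real poly" where
  "pi_poly m lam b n =
    (THE p. is_arg_min (\<lambda>q. (pnorm m lam b q)\<^sup>2)
                       (\<lambda>q. degree q \<le> n \<and> poly.coeff q n = 1) p)"

definition zeta_poly :: "nat \<Rightarrow> (nat \<Rightarrow> real) \<Rightarrow> (nat \<Rightarrow> real) \<Rightarrow> nat \<Rightarrow> nat \<Rightarrow> real poly" where
  "zeta_poly d lam b n j =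
    (THE p. is_arg_min (\<lambda>q. (pnorm d lam b q)\<^sup>2)
                       (\<lambda>q. degree q \<le> n \<and> poly q (lam j) = 1) p)"

definition varsigma :: "nat \<Rightarrow> (nat \<Rightarrow> real) \<Rightarrow> (nat \<Rightarrow> real) \<Rightarrow> nat \<Rightarrow> real poly" where
  "varsigma d lam b n =
    Polynomial.smult (1 / poly (pi_poly d lam b n) 0) (pi_poly d lam b n)"

definition xi_poly :: "nat \<Rightarrow> (nat \<Rightarrow> real) \<Rightarrow> (nat \<Rightarrow> real) \<Rightarrow> nat \<Rightarrow> nat \<Rightarrow> real poly" where
  "xi_poly d lam b n j =
    Polynomial.smult (1 / poly (zeta_poly d lam b n j) 0) (zeta_poly d lam b n j)"

text \<open>The dimension \<open>dt - d\<close> may be \<open>0\<close>; the vector is then empty.\<close>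

definition sigma_vec ::
    "nat \<Rightarrow> nat \<Rightarrow> (nat \<Rightarrow> real) \<Rightarrow> (nat \<Rightarrow> real) \<Rightarrow> nat \<Rightarrow> real vec" where
  "sigma_vec d dt lam b n =
    (let r = dt - d;
         B = mat_diag r (\<lambda>i. b (d + 1 + i));
         C = mat r r (\<lambda>(i, j). poly (xi_poly d lam b (n - 1) (d + 1 + j)) (lam (d + 1 + i)));
         D = mat_diag r (\<lambda>j. (pnorm d lam b (xi_poly d lam b (n - 1) (d + 1 + j)))\<^sup>2
                              / poly (xi_poly d lam b (n - 1) (d + 1 + j)) (lam (d + 1 + j)));
         w = vec r (\<lambda>i. poly (varsigma d lam b n) (lam (d + 1 + i)))
     in the (mat_inverse (D + (B ^\<^sub>m 2) * C)) *\<^sub>v ((B ^\<^sub>m 2) *\<^sub>v w))"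

definition l1_norm :: "real vec \<Rightarrow> real" where
  "l1_norm v = (\<Sum>j<dim_vec v. \<bar>v $ j\<bar>)"

text \<open>All roots of the polynomials this is applied to are real, so nothing is lost by taking
  roots in the reals.\<close>

definition smallest_root :: "real poly \<Rightarrow> real" where
  "smallest_root p = Min {x. poly p x = 0}"

end

theory Submission
  imports Defs
begin

text \<open>
  Let \<open>K\<^sub>y\<close> be the reproducing kernel of the polynomials of degree less than \<open>n\<close>, so that
  \<open>\<langle>K\<^sub>y, q\<rangle> = q(y)\<close>. Then \<open>\<xi>\<^sup>j = K\<^sub>y / K\<^sub>y(0)\<close> with \<open>y = \<lambda>\<^sub>j\<close>, and
  the equation for \<open>\<sigma>\<close> says precisely that \<open>\<varsigma>\<^sub>n - (\<Sum>j. \<sigma>\<^sub>j \<xi>\<^sup>j)\<close> is orthogonal to all of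
  these polynomials for the product with a tilde; hence it is a multiple of the monic minimizer for
  that product. Over the roots \<open>c\<close> of \<open>\<pi>\<^sub>n\<close>, the polynomials \<open>L\<^sub>c = \<pi>\<^sub>n / (x - c)\<close> form an
  orthogonal basis, which gives
  \<open>K\<^sub>y(x) = \<pi>\<^sub>n(x) \<pi>\<^sub>n(y) (\<Sum>c. 1 / ((c - x) (c - y) \<parallel>L\<^sub>c\<parallel>\<^sup>2))\<close>. When \<open>y\<close> and \<open>x\<close> lie
  below the smallest root \<open>\<gamma>\<close>, all summands are positive, and comparing them with those at
  \<open>x = 0\<close> shows that \<open>\<xi>\<^sup>j(x) / \<varsigma>\<^sub>n(x)\<close> is positive and at most \<open>1\<close> if \<open>x \<le> 0\<close>,
  and at most \<open>\<gamma> / (\<gamma> - x)\<close> if \<open>x \<ge> 0\<close>. So the perturbation cannot cancel \<open>\<varsigma>\<^sub>n\<close> to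
  the left of \<open>(1 - \<parallel>\<sigma>\<parallel>\<^sub>1) \<gamma>\<close>.
\<close>

section \<open>Matrices and linear factors\<close>

lemma (in vec_space) rank_eq_card_lin_indpt_cols:
  assumes "A \<in> carrier_mat n nc"
  obtains S where "S \<subseteq> set (cols A)" "lin_indpt S" "rank A = card S"
proof -
  obtain S where S: "maximal S (\<lambda>T. T \<subseteq> set (cols A) \<and> lin_indpt T)"
    using maximal_exists[of "(\<lambda>T. T \<subseteq> set (cols A) \<and> lin_indpt T)" "card (set (cols A))" "{}"]
    by (meson List.finite_set card_mono empty_iff empty_subsetI finite_lin_indpt2 rev_finite_subset)
  with rank_card_indpt[OF assms S] show thesis by (auto simp: maximal_def intro: that)
qed

lemma (in vec_space) rank_le_card_cols:
  assumes "A \<in> carrier_mat n nc"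
  shows "rank A \<le> card (set (cols A))"
  by (rule rank_eq_card_lin_indpt_cols[OF assms]) (simp add: card_mono)

lemma (in vec_space) rank_le_dim_row:
  assumes A: "A \<in> carrier_mat n nc"
  shows "rank A \<le> n"
proof -
  obtain S where S: "S \<subseteq> set (cols A)" "lin_indpt S" "rank A = card S"
    by (rule rank_eq_card_lin_indpt_cols[OF A])
  moreover have "S \<subseteq> carrier_vec n" using S(1) cols_dim A by blast
  ultimately show ?thesis using li_le_dim(2)[of S] dim_is_n by simp
qed

text \<open>\<open>lin_indpt\<close> concerns the set of columns and so does not see repetitions;
  the bound \<open>rank_le_card_cols\<close> excludes them.\<close>

lemma (in vec_space) full_col_rank_kernel_trivial:
  assumes A: "A \<in> carrier_mat n nc" and rank: "rank A = nc"
    and v: "v \<in> carrier_vec nc" "A *\<^sub>v v = 0\<^sub>v n"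
  shows "v = 0\<^sub>v nc"
proof -
  have "distinct (cols A)"
    using rank_le_card_cols[OF A] rank A card_length[of "cols A"]
    by (intro card_distinct) auto
  with full_rank_lin_indpt[OF A rank] lin_depI[OF A v(1) _ v(2)] show ?thesis by blast
qed

lemma mat_diag_pow: "mat_diag d f ^\<^sub>m k = mat_diag d (\<lambda>i. (f i :: 'a :: comm_ring_1) ^ k)"
  by (induction k) (simp_all add: mult.commute, auto simp: mat_diag_def)

lemma mat_diag_mult_vec:
  assumes "v \<in> carrier_vec d"
  shows "mat_diag d f *\<^sub>v v = vec d (\<lambda>i. (f i :: 'a :: comm_ring_1) * v $ i)"
proof (rule eq_vecI)
  fix i assume "i < dim_vec (vec d (\<lambda>i. f i * v $ i))"
  then have i: "i < d" by simp
  have "(mat_diag d f *\<^sub>v v) $ i = (\<Sum>j = 0..<d. (if i = j then f j else 0) * v $ j)"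
    using i assms by (simp add: mat_diag_def scalar_prod_def)
  also have "\<dots> = (\<Sum>j = 0..<d. if j = i then f i * v $ i else 0)"
    by (rule sum.cong) auto
  finally show "(mat_diag d f *\<^sub>v v) $ i = vec d (\<lambda>i. f i * v $ i) $ i"
    using i by simp
qed (simp add: mat_diag_def)

lemma degree_linear_prod: "degree (\<Prod>c\<in>S. [:-c, 1::real:]) = card S"
  by (subst degree_prod_eq_sum_degree) auto

lemma linear_prod_dvd:
  assumes "finite S" "\<And>c. c \<in> S \<Longrightarrow> poly p c = 0"
  shows "(\<Prod>c\<in>S. [:-c, 1::real:]) dvd p"
  using assms
proof (induction S)
  case (insert x S)
  then have "(\<Prod>c\<in>S. [:-c, 1:]) dvd p" by simp
  then obtain q where q: "p = (\<Prod>c\<in>S. [:-c, 1:]) * q" by (rule dvdE)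
  have "poly (\<Prod>c\<in>S. [:-c, 1:]) x \<noteq> 0"
    using insert.hyps by (auto simp: poly_prod)
  with insert.prems[of x] have "poly q x = 0" unfolding q by simp
  then have "[:-x, 1:] dvd q" by (simp add: poly_eq_0_iff_dvd)
  then show ?case unfolding q prod.insert[OF insert.hyps(1,2)]
    by (metis mult.commute mult_dvd_mono dvd_refl)
qed simp

section \<open>The semi-inner products and their minimizers\<close>

lemma ip_nonneg: "0 \<le> ip m lam b p p"
  unfolding ip_def by (intro sum_nonneg) (simp add: mult.assoc)

lemma ip_eq_0D:
  assumes "ip m lam b p p = 0" "i \<in> {1..m}"
  shows "b i * poly p (lam i) = 0"
proof -
  have "(\<Sum>i=1..m. (b i * poly p (lam i))\<^sup>2) = 0"
    using assms(1) unfolding ip_def by (simp add: power2_eq_square mult_ac)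
  with assms(2) show ?thesis by (subst (asm) sum_nonneg_eq_0_iff) auto
qed

text \<open>A vanishing norm means p(A) b = 0, so the coefficient vector of \<open>p\<close> lies in
  the kernel of the Krylov matrix \<open>M l\<close>, which has full column rank when
  \<open>l\<close> is the grade.\<close>

lemma ip_positive_definite_below_grade:
  assumes n: "n \<le> grade d lam b" and p: "degree p < n" "ip d lam b p p = 0"
  shows "p = 0"
proof -
  interpret vec_space "TYPE(real)" d .
  define M where "M l = mat_of_cols d (map (\<lambda>k. (mat_diag d (\<lambda>i. lam (i + 1)) ^\<^sub>m k)
    *\<^sub>v vec d (\<lambda>i. b (i + 1))) [0..<l])" for l
  have M: "M l \<in> carrier_mat d l" for l unfolding M_def by auto
  \<comment> \<open>\<open>GREATEST\<close> is attained because there is a witness, 0, and an upper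
    bound, \<open>d\<close>.\<close>
  have "rank (M 0) \<le> 0" using rank_le_nc[OF M[of 0]] .
  then have r0: "rank (M 0) = 0" by simp
  have bnd: "l \<le> d" if "rank (M l) = l" for l
    using rank_le_dim_row[OF M[of l]] that by simp
  define l where "l = grade d lam b"
  have l: "l = (GREATEST n. rank (M n) = n)"
    unfolding l_def grade_def M_def Let_def by simp
  have rl: "rank (M l) = l"
    unfolding l by (rule GreatestI_nat[where b = d]) (use r0 bnd in auto)
  have deg: "degree p < l" using n p unfolding l_def by simp
  have "M l *\<^sub>v vec l (poly.coeff p) = 0\<^sub>v d"
  proof (rule eq_vecI)
    fix i assume i: "i < dim_vec (0\<^sub>v d)"
    have "(M l *\<^sub>v vec l (poly.coeff p)) $ i
        = (\<Sum>k<l. lam (i + 1) ^ k * b (i + 1) * poly.coeff p k)"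
      using i by (simp add: M_def scalar_prod_def mat_of_cols_def mat_diag_pow mat_diag_mult_vec
          atLeast0LessThan)
    also have "\<dots> = b (i + 1) * (\<Sum>k<l. poly.coeff p k * lam (i + 1) ^ k)"
      by (simp add: sum_distrib_left mult_ac)
    also have "(\<Sum>k<l. poly.coeff p k * lam (i + 1) ^ k) = poly p (lam (i + 1))"
      unfolding poly_altdef
      by (rule sum.mono_neutral_right) (use deg in \<open>auto simp: coeff_eq_0\<close>)
    also have "b (i + 1) * \<dots> = 0" using ip_eq_0D[OF p(2), of "i + 1"] i by simp
    finally show "(M l *\<^sub>v vec l (poly.coeff p)) $ i = 0\<^sub>v d $ i" using i by simp
  qed (simp add: carrier_matD(1)[OF M])
  then have v0: "vec l (poly.coeff p) = 0\<^sub>v l"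
    using full_col_rank_kernel_trivial[OF M rl] by simp
  have "poly.coeff p k = 0" for k
  proof (cases "k < l")
    case True
    with arg_cong[OF v0, of "\<lambda>v. v $ k"] show ?thesis by simp
  qed (use deg in \<open>simp add: coeff_eq_0\<close>)
  then show ?thesis by (simp add: poly_eq_iff)
qed

lemma ip_commute: "ip m lam b p q = ip m lam b q p"
  unfolding ip_def by (simp add: mult_ac)

lemma ip_linear_left:
  "ip m lam b 0 r = 0"
  "ip m lam b (p + q) r = ip m lam b p r + ip m lam b q r"
  "ip m lam b (p - q) r = ip m lam b p r - ip m lam b q r"
  "ip m lam b (Polynomial.smult c p) r = c * ip m lam b p r"
  unfolding ip_def
  by (simp_all add: algebra_simps sum.distrib sum_subtractf sum_distrib_left)

lemma ip_sum_left: "ip m lam b (\<Sum>i\<in>I. f i) r = (\<Sum>i\<in>I. ip m lam b (f i) r)"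
  by (induction I rule: infinite_finite_induct) (auto simp: ip_linear_left)

lemma ip_linear_right:
  "ip m lam b r 0 = 0"
  "ip m lam b r (p + q) = ip m lam b r p + ip m lam b r q"
  "ip m lam b r (p - q) = ip m lam b r p - ip m lam b r q"
  "ip m lam b r (Polynomial.smult c p) = c * ip m lam b r p"
  unfolding ip_commute[of _ _ _ r] by (simp_all add: ip_linear_left)

lemma ip_sum_right: "ip m lam b r (\<Sum>i\<in>I. f i) = (\<Sum>i\<in>I. ip m lam b r (f i))"
  unfolding ip_commute[of _ _ _ r] by (rule ip_sum_left)

lemma pnorm_power2: "(pnorm m lam b p)\<^sup>2 = ip m lam b p p"
  unfolding pnorm_def by (simp add: ip_nonneg)

text \<open>Pythagoras. A semi-norm may have several minimizers, hence the separate assumption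
  \<open>uniq\<close>. The predicate \<open>P\<close> covers both the monic and the point-value
  constraint.\<close>

lemma the_arg_min_pnorm_eqI:
  assumes "P p"
    and orth: "\<And>q. P q \<Longrightarrow> ip m lam b p (q - p) = 0"
    and uniq: "\<And>q. P q \<Longrightarrow> ip m lam b (q - p) (q - p) = 0 \<Longrightarrow> q = p"
  shows "(THE p. is_arg_min (\<lambda>q. (pnorm m lam b q)\<^sup>2) P p) = p"
proof -
  have pyth: "ip m lam b q q = ip m lam b p p + ip m lam b (q - p) (q - p)" if "P q" for q
    using orth[OF that] by (simp add: ip_linear_left ip_linear_right ip_commute[of _ _ _ q p])
  show ?thesis
  proof (rule the_equality)
    show "is_arg_min (\<lambda>q. (pnorm m lam b q)\<^sup>2) P p"
      unfolding is_arg_min_linorder pnorm_power2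
      using assms(1) pyth ip_nonneg[of m lam b] by (metis le_add_same_cancel1)
  next
    fix q assume "is_arg_min (\<lambda>q. (pnorm m lam b q)\<^sup>2) P q"
    then have "P q" "ip m lam b q q \<le> ip m lam b p p"
      using assms(1) unfolding is_arg_min_linorder pnorm_power2 by auto
    then show "q = p"
      using pyth[of q] uniq[of q] ip_nonneg[of m lam b "q - p"] by linarith
  qed
qed

text \<open>The parameter \<open>m\<close> stays free because both products are instances, with
  \<open>d\<close> and with \<open>dt\<close>.\<close>

locale definite_ip =
  fixes m :: nat and lam b :: "nat \<Rightarrow> real" and n :: nat
  assumes definite: "degree p < n \<Longrightarrow> ip m lam b p p = 0 \<Longrightarrow> p = 0"
    and n_pos: "0 < n"
begin

text \<open>Gram-Schmidt by induction on \<open>k\<close>. Degree less than \<open>k\<close> is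
  expressed by vanishing coefficients, so that \<open>k = 0\<close> describes the zero
  space.\<close>

lemma ex_orthogonal_projection:
  assumes "k \<le> n"
  shows "\<exists>g. (\<forall>i\<ge>k. poly.coeff g i = 0) \<and>
    (\<forall>q. (\<forall>i\<ge>k. poly.coeff q i = 0) \<longrightarrow> ip m lam b (f - g) q = 0)"
  using assms
proof (induction k arbitrary: f)
  case 0
  show ?case by (rule exI[of _ 0]) (auto simp: ip_linear_right simp flip: poly_eq_iff[of _ 0, simplified])
next
  case (Suc k)
  \<comment> \<open>Projecting the monomial yields the next orthogonal basis element
    \<open>e\<close>, monic of degree \<open>k\<close>.\<close>
  obtain h where h: "\<And>i. i \<ge> k \<Longrightarrow> poly.coeff h i = 0"
      "\<And>q. \<forall>i\<ge>k. poly.coeff q i = 0 \<Longrightarrow> ip m lam b (monom 1 k - h) q = 0"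
    using Suc.IH[of "monom 1 k"] Suc.prems by auto
  obtain g where g: "\<And>i. i \<ge> k \<Longrightarrow> poly.coeff g i = 0"
      "\<And>q. \<forall>i\<ge>k. poly.coeff q i = 0 \<Longrightarrow> ip m lam b (f - g) q = 0"
    using Suc.IH[of f] Suc.prems by auto
  define e where "e = monom 1 k - h"
  have ek: "poly.coeff e k = 1" "\<And>i. i > k \<Longrightarrow> poly.coeff e i = 0"
    using h(1) unfolding e_def by auto
  have "degree e \<le> k" using ek(2) by (intro degree_le) auto
  moreover have "e \<noteq> 0" using ek(1) by auto
  ultimately have ee: "ip m lam b e e \<noteq> 0" using definite[of e] Suc.prems by auto
  define t where "t = ip m lam b f e / ip m lam b e e"
  have ge: "ip m lam b g e = 0"
    using h(2)[of g] g(1) unfolding e_def ip_commute[of _ _ _ g] by auto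
  show ?case
  proof (intro exI[of _ "g + Polynomial.smult t e"] conjI allI impI)
    fix i assume "i \<ge> Suc k"
    then show "poly.coeff (g + Polynomial.smult t e) i = 0" using g(1)[of i] ek(2)[of i] by simp
  next
    fix q :: "real poly" assume q: "\<forall>i\<ge>Suc k. poly.coeff q i = 0"
    \<comment> \<open>Orthogonality is tested separately on the part of \<open>q\<close> below
      degree \<open>k\<close> and on \<open>e\<close>.\<close>
    define q0 where "q0 = q - Polynomial.smult (poly.coeff q k) e"
    have q0: "\<forall>i\<ge>k. poly.coeff q0 i = 0"
    proof (intro allI impI)
      fix i assume "i \<ge> k"
      then show "poly.coeff q0 i = 0"
        using q ek unfolding q0_def by (cases "i = k") auto
    qed
    have "ip m lam b (f - (g + Polynomial.smult t e)) q0 = 0"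
      using g(2)[OF q0] h(2)[OF q0] by (simp add: ip_linear_left e_def)
    moreover have "ip m lam b (f - (g + Polynomial.smult t e)) e = 0"
      using ge ee by (simp add: ip_linear_left t_def)
    moreover have "q = q0 + Polynomial.smult (poly.coeff q k) e" unfolding q0_def by simp
    ultimately show "ip m lam b (f - (g + Polynomial.smult t e)) q = 0"
      by (metis ip_linear_right(2,4) add_0 mult_zero_right)
  qed
qed

lemma degree_less_if_coeff_eq_0:
  fixes q :: "real poly"
  assumes "degree q \<le> n" "poly.coeff q n = 0"
  shows "degree q < n"
  using assms n_pos by (metis degree_0 leading_coeff_0_iff nat_less_le)

text \<open>Two monic competitors differ by a polynomial of degree less than \<open>n\<close>. This
  criterion later identifies the minimizer for the product with a tilde.\<close>

lemma pi_poly_eqI: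
  assumes "degree p \<le> n" "poly.coeff p n = 1"
    and "\<And>q. degree q < n \<Longrightarrow> ip m lam b p q = 0"
  shows "pi_poly m lam b n = p"
  unfolding pi_poly_def
proof (rule the_arg_min_pnorm_eqI)
  fix q :: "real poly" assume q: "degree q \<le> n \<and> poly.coeff q n = 1"
  then have "degree (q - p) < n"
    using assms by (intro degree_less_if_coeff_eq_0 degree_diff_le) auto
  then show "ip m lam b p (q - p) = 0" "ip m lam b (q - p) (q - p) = 0 \<Longrightarrow> q = p"
    using assms(3) definite[of "q - p"] by auto
qed (use assms in auto)

lemma
  shows coeff_pi_poly: "poly.coeff (pi_poly m lam b n) n = 1"
    and degree_pi_poly: "degree (pi_poly m lam b n) = n"
    and ip_pi_poly: "degree q < n \<Longrightarrow> ip m lam b (pi_poly m lam b n) q = 0"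
proof -
  obtain g where g: "\<And>i. i \<ge> n \<Longrightarrow> poly.coeff g i = 0"
      "\<And>q. \<forall>i\<ge>n. poly.coeff q i = 0 \<Longrightarrow> ip m lam b (monom 1 n - g) q = 0"
    using ex_orthogonal_projection[of n "monom 1 n"] by auto
  let ?p = "monom 1 n - g"
  have p: "poly.coeff ?p n = 1" "degree ?p \<le> n" "\<And>q. degree q < n \<Longrightarrow> ip m lam b ?p q = 0"
    using g by (auto intro!: degree_le simp: coeff_eq_0)
  then have "pi_poly m lam b n = ?p" by (intro pi_poly_eqI)
  with p show "poly.coeff (pi_poly m lam b n) n = 1"
    and "degree q < n \<Longrightarrow> ip m lam b (pi_poly m lam b n) q = 0"
    and "degree (pi_poly m lam b n) = n"
    by (auto intro!: antisym le_degree)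
qed

end

section \<open>The reproducing kernel\<close>

locale definite_ip_right = definite_ip +
  fixes a :: real
  assumes lam_ge: "i \<in> {1..m} \<Longrightarrow> a \<le> lam i"
begin

abbreviation ppi :: "real poly" where "ppi \<equiv> pi_poly m lam b n"

section \<open>Location and simplicity of the roots\<close>

definition R :: "real set" where "R = {x. poly ppi x = 0}"

lemma ppi_nonzero: "ppi \<noteq> 0"
  using coeff_pi_poly by auto

lemma finite_R: "finite R"
  unfolding R_def by (rule poly_roots_finite[OF ppi_nonzero])

text \<open>For a root \<open>c < a\<close>, the product of \<open>ppi\<close> with its cofactor
  \<open>q\<close> is 0, but it is also a sum of squares with weights
  \<open>lam i - c > 0\<close>.\<close>

lemma roots_ge:
  assumes "c \<in> R"
  shows "a \<le> c"
proof (rule ccontr)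
  assume ca: "\<not> a \<le> c"
  obtain q where q: "ppi = [:-c, 1:] * q"
    using assms unfolding R_def by (auto simp: poly_eq_0_iff_dvd)
  with ppi_nonzero have "q \<noteq> 0" by auto
  then have "degree q < n"
    using degree_pi_poly unfolding q by (simp add: degree_mult_eq del: mult_pCons_left)
  then have "(\<Sum>i=1..m. (b i * poly q (lam i))\<^sup>2 * (lam i - c)) = 0"
    using ip_pi_poly[of q] unfolding q ip_def by (simp add: power2_eq_square algebra_simps)
  then have "\<forall>i\<in>{1..m}. (b i * poly q (lam i))\<^sup>2 * (lam i - c) = 0"
    using ca lam_ge by (subst (asm) sum_nonneg_eq_0_iff) force+
  then have "\<forall>i\<in>{1..m}. b i * poly q (lam i) = 0"
    using ca lam_ge by fastforce
  then have "ip m lam b q q = 0"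
    unfolding ip_def by (intro sum.neutral) (auto simp: power2_eq_square)
  with definite[of q] \<open>degree q < n\<close> \<open>q \<noteq> 0\<close> show False by simp
qed

text \<open>If \<open>ppi\<close> is (x - c)^2 q, then the squared norm of (x - c) q equals the
  product of \<open>ppi\<close> with \<open>q\<close>, which is 0.\<close>

lemma roots_simple: "\<not> [:-c, 1:] * [:-c, 1:] dvd ppi"
proof
  assume "[:-c, 1:] * [:-c, 1:] dvd ppi"
  then obtain q where "ppi = [:-c, 1:] * [:-c, 1:] * q" by (rule dvdE)
  then have q: "ppi = [:-c, 1:] * ([:-c, 1:] * q)" by (simp only: mult.assoc)
  with ppi_nonzero have "q \<noteq> 0" by auto
  then have deg: "degree q < n" "degree ([:-c, 1:] * q) < n"
    using degree_pi_poly unfolding q by (simp_all add: degree_mult_eq del: mult_pCons_left)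
  have "ip m lam b ([:-c, 1:] * q) ([:-c, 1:] * q) = ip m lam b ppi q"
    unfolding q ip_def by (simp add: algebra_simps)
  also have "\<dots> = 0" by (rule ip_pi_poly[OF deg(1)])
  finally have "[:-c, 1:] * q = 0" using definite[OF deg(2)] by simp
  with \<open>q \<noteq> 0\<close> show False by (simp del: mult_pCons_left)
qed

text \<open>If \<open>\<pi>\<^sub>n\<close> had fewer than \<open>n\<close> real roots, it would be orthogonal to the product of the
  corresponding linear factors, although its product with that polynomial does not change sign.\<close>

lemma ppi_eq_prod: "ppi = (\<Prod>c\<in>R. [:-c, 1:])"
proof -
  define p where "p = (\<Prod>c\<in>R. [:-c, 1::real:])"
  have "p dvd ppi" unfolding p_def by (rule linear_prod_dvd[OF finite_R]) (simp add: R_def)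
  then obtain q where q: "ppi = p * q" by (rule dvdE)
  with ppi_nonzero have nz: "q \<noteq> 0" "p \<noteq> 0" by auto
  \<comment> \<open>A root of \<open>q\<close> is a root of \<open>ppi\<close>, hence of
    \<open>p\<close> as well, and would be double.\<close>
  have noroot: "poly q x \<noteq> 0" for x
  proof
    assume x: "poly q x = 0"
    then have "x \<in> R" unfolding R_def q by simp
    then have "[:-x, 1:] dvd p" unfolding p_def using dvd_prodI[OF finite_R \<open>x \<in> R\<close>, of "\<lambda>c. [:-c, 1:]"] by blast
    moreover have "[:-x, 1:] dvd q" using x by (simp add: poly_eq_0_iff_dvd)
    ultimately show False using roots_simple[of x] unfolding q by (blast intro: mult_dvd_mono)
  qed
  have sgn: "0 < poly q x * poly q y" for x y
  proof (rule ccontr)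
    assume "\<not> 0 < poly q x * poly q y"
    then have "poly q x * poly q y < 0" using noroot[of x] noroot[of y]
      by (metis linorder_neqE_linordered_idom mult_eq_0_iff)
    then show False using poly_IVT[of x y q] poly_IVT[of y x q] noroot
      by (metis linorder_neqE_linordered_idom mult.commute not_square_less_zero)
  qed
  have "degree q = 0"
  proof (rule ccontr)
    assume "degree q \<noteq> 0"
    then have deg: "degree p < n"
      using degree_pi_poly nz unfolding q by (simp add: degree_mult_eq)
    \<comment> \<open>The factor \<open>poly q 0\<close> makes all summands nonnegative, whichever
      sign \<open>q\<close> has.\<close>
    have "0 = poly q 0 * ip m lam b ppi p" using ip_pi_poly[OF deg] by simp
    also have "\<dots> = (\<Sum>i=1..m. (b i * poly p (lam i))\<^sup>2 * (poly q 0 * poly q (lam i)))"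
      unfolding q ip_def by (simp add: sum_distrib_left power2_eq_square mult_ac)
    finally have "\<forall>i\<in>{1..m}. (b i * poly p (lam i))\<^sup>2 * (poly q 0 * poly q (lam i)) = 0"
      using sgn by (subst (asm) eq_commute, subst (asm) sum_nonneg_eq_0_iff)
        (auto intro!: mult_nonneg_nonneg[OF zero_le_power2 less_imp_le])
    then have "\<forall>i\<in>{1..m}. b i * poly p (lam i) = 0" using noroot by auto
    then have "ip m lam b p p = 0"
      unfolding ip_def by (intro sum.neutral) (auto simp: power2_eq_square)
    with definite[OF deg] nz show False by simp
  qed
  moreover have "lead_coeff p = 1" unfolding p_def by (simp add: lead_coeff_prod)
  moreover have "lead_coeff ppi = 1" using coeff_pi_poly degree_pi_poly by simp
  ultimately have "q = 1" unfolding q lead_coeff_mult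
    by (metis mult_1 degree_0_id pCons_one of_nat_1 degree_eq_zeroE coeff_pCons_0)
  with q show ?thesis unfolding p_def by simp
qed

lemma card_R: "card R = n"
  using degree_pi_poly degree_linear_prod[of R] by (simp flip: ppi_eq_prod)

lemma R_nonempty: "R \<noteq> {}"
  using card_R n_pos by auto

section \<open>Orthogonal Lagrange basis and kernel\<close>

definition L :: "real \<Rightarrow> real poly" where "L c = (\<Prod>z\<in>R - {c}. [:-z, 1:])"

definition N :: "real \<Rightarrow> real" where "N c = ip m lam b (L c) (L c)"

definition kern :: "real \<Rightarrow> real poly" where
  "kern y = (\<Sum>c\<in>R. Polynomial.smult (poly (L c) y / N c) (L c))"

lemma degree_L: "c \<in> R \<Longrightarrow> degree (L c) < n"
  unfolding L_def degree_linear_prod using card_R finite_R n_pos by simp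

lemma poly_L_root: "c \<in> R \<Longrightarrow> c' \<in> R \<Longrightarrow> poly (L c) c' = 0 \<longleftrightarrow> c \<noteq> c'"
  unfolding L_def poly_prod using finite_R by auto

text \<open>Moving the factor x - c' from \<open>L c\<close> to \<open>L c'\<close> turns the latter
  into \<open>ppi\<close> and leaves a polynomial of degree n - 2 on the other side.\<close>

lemma L_orthogonal:
  assumes "c \<in> R" "c' \<in> R" "c \<noteq> c'"
  shows "ip m lam b (L c) (L c') = 0"
proof -
  have "L c = [:-c', 1:] * (\<Prod>z\<in>R - {c} - {c'}. [:-z, 1:])"
    unfolding L_def by (rule prod.remove) (use assms finite_R in auto)
  moreover have "R - {c} - {c'} = R - {c, c'}" by auto
  ultimately have 1: "L c = [:-c', 1:] * (\<Prod>z\<in>R - {c, c'}. [:-z, 1:])" by simp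
  have 2: "ppi = [:-c', 1:] * L c'"
    unfolding ppi_eq_prod L_def by (rule prod.remove[OF finite_R assms(2)])
  have "ip m lam b (L c) (L c') = ip m lam b ppi (\<Prod>z\<in>R - {c, c'}. [:-z, 1:])"
    unfolding 1 2 ip_def by (simp add: algebra_simps)
  also have "\<dots> = 0"
    by (rule ip_pi_poly) (use assms card_R finite_R n_pos in \<open>auto simp: degree_linear_prod card_Diff_subset\<close>)
  finally show ?thesis .
qed

lemma N_pos:
  assumes "c \<in> R"
  shows "0 < N c"
proof -
  have "L c \<noteq> 0" unfolding L_def using finite_R by simp
  with definite[OF degree_L[OF assms]] have "N c \<noteq> 0" unfolding N_def by auto
  with ip_nonneg show ?thesis unfolding N_def by (metis order_le_less)
qed

lemma lagrange:
  assumes "degree q < n"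
  shows "q = (\<Sum>c\<in>R. Polynomial.smult (poly q c / poly (L c) c) (L c))" (is "_ = ?r")
proof (rule poly_eqI_degree[where A = R])
  show "degree q < card R" using assms card_R by simp
  show "degree ?r < card R" unfolding card_R
    by (rule degree_sum_less) (use degree_L n_pos in \<open>auto intro: le_less_trans[OF degree_smult_le]\<close>)
next
  fix x assume x: "x \<in> R"
  have "poly ?r x = (\<Sum>c\<in>R. if c = x then poly q x else 0)"
    unfolding poly_sum by (rule sum.cong) (use x poly_L_root in auto)
  then show "poly q x = poly ?r x" using x finite_R by simp
qed

lemma degree_kern: "degree (kern y) < n"
  unfolding kern_def
  by (rule degree_sum_less) (use degree_L n_pos in \<open>auto intro: le_less_trans[OF degree_smult_le]\<close>)

text \<open>By orthogonality, the product of \<open>q\<close> with \<open>L c\<close> is a multiple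
  of the value of \<open>q\<close> at \<open>c\<close>; summing over \<open>c\<close> rebuilds the
  Lagrange interpolant of \<open>q\<close> at \<open>y\<close>.\<close>

lemma ip_kern:
  assumes "degree q < n"
  shows "ip m lam b (kern y) q = poly q y"
proof -
  have L: "ip m lam b (L c) q = poly q c / poly (L c) c * N c" if c: "c \<in> R" for c
  proof -
    have "ip m lam b (L c) q = (\<Sum>c'\<in>R. poly q c' / poly (L c') c' * ip m lam b (L c) (L c'))"
      by (subst lagrange[OF assms]) (simp add: ip_sum_right ip_linear_right)
    also have "\<dots> = (\<Sum>c'\<in>R. if c' = c then poly q c / poly (L c) c * N c else 0)"
      by (rule sum.cong) (use c L_orthogonal N_def in auto)
    finally show ?thesis using c finite_R by simp
  qed
  have "ip m lam b (kern y) q = (\<Sum>c\<in>R. poly (L c) y / N c * ip m lam b (L c) q)"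
    unfolding kern_def by (simp add: ip_sum_left ip_linear_left)
  also have "\<dots> = (\<Sum>c\<in>R. poly q c / poly (L c) c * poly (L c) y)"
    by (rule sum.cong) (use L N_pos in \<open>auto simp: less_imp_neq[symmetric]\<close>)
  also have "\<dots> = poly q y"
    by (subst (2) lagrange[OF assms]) (simp add: poly_sum)
  finally show ?thesis .
qed

text \<open>The value is the squared norm of \<open>kern y\<close>, and \<open>kern y\<close> is
  nonzero because it reproduces the constant 1.\<close>

lemma poly_kern_diag_pos: "0 < poly (kern y) y"
proof -
  have "ip m lam b (kern y) (kern y) \<noteq> 0"
  proof
    assume "ip m lam b (kern y) (kern y) = 0"
    then have "kern y = 0" using definite[OF degree_kern] by simp
    then show False using ip_kern[of 1 y] n_pos by (simp add: ip_linear_left)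
  qed
  with ip_nonneg[of m lam b "kern y"] show ?thesis by (simp add: ip_kern[OF degree_kern])
qed

text \<open>What remains of the kernel once \<open>ppi\<close> is factored out at both points. The
  differences are oriented so as to be positive to the left of the roots.\<close>

definition S :: "real \<Rightarrow> real \<Rightarrow> real" where
  "S x y = (\<Sum>c\<in>R. 1 / ((c - x) * (c - y) * N c))"

lemma poly_kern:
  assumes "x \<notin> R" "y \<notin> R"
  shows "poly (kern y) x = poly ppi x * poly ppi y * S x y"
proof -
  have L: "poly (L c) z = poly ppi z / (z - c)" if "c \<in> R" "z \<notin> R" for c z
  proof -
    have "ppi = [:-c, 1:] * L c"
      unfolding ppi_eq_prod L_def using that finite_R by (simp add: prod.remove del: mult_pCons_left)
    then have "poly ppi z = poly ([:-c, 1:] * L c) z" by (rule arg_cong)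
    then have "poly ppi z = (z - c) * poly (L c) z" by (simp add: algebra_simps)
    moreover have "z \<noteq> c" using that by auto
    ultimately show ?thesis by simp
  qed
  have "poly (kern y) x = (\<Sum>c\<in>R. poly (L c) y / N c * poly (L c) x)"
    unfolding kern_def by (simp add: poly_sum)
  also have "\<dots> = (\<Sum>c\<in>R. poly ppi x * poly ppi y * (1 / ((c - x) * (c - y) * N c)))"
  proof (rule sum.cong)
    fix c assume c: "c \<in> R"
    then have "c \<noteq> x" "c \<noteq> y" "N c \<noteq> 0" using assms N_pos by force+
    then show "poly (L c) y / N c * poly (L c) x
        = poly ppi x * poly ppi y * (1 / ((c - x) * (c - y) * N c))"
      unfolding L[OF c assms(1)] L[OF c assms(2)] by (simp add: field_simps)
  qed simp
  finally show ?thesis unfolding S_def by (simp add: sum_distrib_left)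
qed

lemma S_pos:
  assumes "\<And>c. c \<in> R \<Longrightarrow> x < c" "\<And>c. c \<in> R \<Longrightarrow> y < c"
  shows "0 < S x y"
  unfolding S_def using assms N_pos R_nonempty finite_R by (intro sum_pos) auto

section \<open>Constrained minimizers as kernels\<close>

text \<open>Competitors differ by a polynomial vanishing at \<open>lam j\<close>, and the
  reproducing property makes \<open>kern (lam j)\<close> orthogonal to it.\<close>

lemma zeta_poly_eq:
  "zeta_poly m lam b (n - 1) j = Polynomial.smult (1 / poly (kern (lam j)) (lam j)) (kern (lam j))"
proof -
  let ?k = "kern (lam j)" let ?z = "Polynomial.smult (1 / poly ?k (lam j)) ?k"
  have dz: "degree ?z < n"
    using degree_kern[of "lam j"] by (auto intro: le_less_trans[OF degree_smult_le])
  have pz: "poly ?z (lam j) = 1" using poly_kern_diag_pos[of "lam j"] by simp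
  show ?thesis unfolding zeta_poly_def
  proof (rule the_arg_min_pnorm_eqI)
    show "degree ?z \<le> n - 1 \<and> poly ?z (lam j) = 1" using dz pz by simp
  next
    fix q :: "real poly" assume q: "degree q \<le> n - 1 \<and> poly q (lam j) = 1"
    then have dq: "degree (q - ?z) < n" using dz n_pos by (intro degree_diff_less) auto
    have "poly (q - ?z) (lam j) = 0" using q pz by (simp del: poly_smult)
    then show "ip m lam b ?z (q - ?z) = 0" by (simp only: ip_linear_left(4) ip_kern[OF dq])
    show "ip m lam b (q - ?z) (q - ?z) = 0 \<Longrightarrow> q = ?z" using definite[OF dq] by auto
  qed
qed

lemma xi_poly_eq:
  "xi_poly m lam b (n - 1) j = Polynomial.smult (1 / poly (kern (lam j)) 0) (kern (lam j))"
  using poly_kern_diag_pos[of "lam j"] unfolding xi_poly_def zeta_poly_eq by simp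

lemma poly_varsigma: "poly (varsigma m lam b n) x = poly ppi x / poly ppi 0"
  unfolding varsigma_def by simp

text \<open>This gives the invertibility of the matrix defining \<sigma>. For the kernel combination
  \<open>g\<close> with coefficients \<open>u\<close>, the assumption reads
  \<open>u i = - (\<beta> i)\<^sup>2 * poly g (y i)\<close>, so the squared norm of \<open>g\<close>
  is minus a sum of squares.\<close>

lemma kern_gram_definite:
  assumes "\<And>i. i < r \<Longrightarrow> u i + (\<beta> i)\<^sup>2 * (\<Sum>j<r. poly (kern (y j)) (y i) * u j) = 0" and "i < r"
  shows "u i = 0"
proof -
  define g where "g = (\<Sum>j<r. Polynomial.smult (u j) (kern (y j)))"
  have deg: "degree g < n" unfolding g_def
    by (rule degree_sum_less) (use degree_kern n_pos in \<open>auto intro: le_less_trans[OF degree_smult_le]\<close>)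
  have g: "poly g (y i) = (\<Sum>j<r. poly (kern (y j)) (y i) * u j)" for i
    unfolding g_def by (simp add: poly_sum mult.commute)
  have u: "u i = - (\<beta> i)\<^sup>2 * poly g (y i)" if "i < r" for i
    using assms(1)[OF that] unfolding g by linarith
  have "ip m lam b g g = (\<Sum>j<r. u j * poly g (y j))"
    by (subst g_def) (simp add: ip_sum_left ip_linear_left ip_kern[OF deg])
  also have "\<dots> = - (\<Sum>j<r. (\<beta> j * poly g (y j))\<^sup>2)"
    unfolding sum_negf[symmetric] by (rule sum.cong) (auto simp: u power2_eq_square)
  also have "\<dots> \<le> 0" by (simp add: sum_nonneg)
  finally have "ip m lam b g g = 0" using ip_nonneg[of m lam b g] by linarith
  with definite[OF deg] u[OF \<open>i < r\<close>] show ?thesis by simp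
qed

section \<open>Kernel ratios to the left of the roots\<close>

lemma Min_R_le: "c \<in> R \<Longrightarrow> Min R \<le> c"
  using finite_R by simp

lemma Min_R_ge: "a \<le> Min R"
  using Min_in[OF finite_R R_nonempty] roots_ge by blast

lemma S_le_nonpos:
  assumes "0 < a" "y < a" "x \<le> 0"
  shows "S x y \<le> S 0 y"
  unfolding S_def
proof (rule sum_mono)
  fix c assume c: "c \<in> R"
  then have "0 < c" "y < c" "0 < N c" using roots_ge[OF c] N_pos assms by auto
  with assms show "1 / ((c - x) * (c - y) * N c) \<le> 1 / ((c - 0) * (c - y) * N c)"
    by (intro divide_left_mono mult_right_mono mult_pos_pos) auto
qed

text \<open>Termwise: t / (t - x) decreases in t > x for nonnegative \<open>x\<close>, so c / (c -
  x) is largest at the smallest root.\<close>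

lemma S_le_nonneg:
  assumes "0 < a" "y < a" "0 \<le> x" "x < Min R"
  shows "S x y \<le> Min R / (Min R - x) * S 0 y"
  unfolding S_def sum_distrib_left
proof (rule sum_mono)
  fix c assume c: "c \<in> R"
  then have pos: "0 < c" "y < c" "0 < N c" "x < c" using roots_ge[OF c] Min_R_le[OF c] N_pos assms by auto
  have "Min R * x \<le> c * x" using Min_R_le[OF c] assms by (intro mult_right_mono)
  then have "1 / (c - x) \<le> Min R / ((Min R - x) * c)"
    using pos assms by (simp add: field_simps)
  then have "1 / (c - x) * (1 / ((c - y) * N c)) \<le> Min R / ((Min R - x) * c) * (1 / ((c - y) * N c))"
    using pos by (intro mult_right_mono) auto
  then show "1 / ((c - x) * (c - y) * N c) \<le> Min R / (Min R - x) * (1 / ((c - 0) * (c - y) * N c))"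
    by (simp add: mult_ac)
qed

lemma kern_at_0_nonzero:
  assumes "0 < a" "y < a"
  shows "poly (kern y) 0 \<noteq> 0"
proof -
  have "0 \<notin> R" "y \<notin> R" using roots_ge assms by force+
  moreover have "0 < S 0 y" using roots_ge assms by (intro S_pos) force+
  ultimately show ?thesis using poly_kern[of 0 y] unfolding R_def by simp
qed

text \<open>Division by \<sigmaf>(x), which is nonzero to the left of the roots, leaves 1 minus a
  sum of absolute value less than 1.\<close>

lemma varsigma_minus_kernels_nonzero:
  assumes a: "0 < a" and y: "\<And>j. j < r \<Longrightarrow> y j < a"
    and s: "(\<Sum>j<r. \<bar>u j\<bar>) < 1" and x: "x < (1 - (\<Sum>j<r. \<bar>u j\<bar>)) * Min R"
  shows "poly (varsigma m lam b n) x - (\<Sum>j<r. u j * (poly (kern (y j)) x / poly (kern (y j)) 0)) \<noteq> 0"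
proof -
  define s where "s = (\<Sum>j<r. \<bar>u j\<bar>)"
  \<comment> \<open>This is the quotient of the normalized kernel by \<open>varsigma\<close> at
    \<open>x\<close>: the factor \<open>poly ppi (y j)\<close> cancels.\<close>
  define e where "e j = S x (y j) / S 0 (y j)" for j
  have s0: "0 \<le> s" unfolding s_def by (rule sum_nonneg) simp
  have M: "0 < Min R" using Min_R_ge a by simp
  have xM: "x < Min R" using x s0 M unfolding s_def[symmetric]
    by (smt (verit) mult_left_le_one_le mult_less_cancel_right2 mult_nonneg_nonneg)
  have nR: "x \<notin> R" "0 \<notin> R" using xM M Min_R_le by force+
  have yR: "y j \<notin> R" if "j < r" for j using roots_ge y[OF that] by force
  have S0: "0 < S 0 (y j)" if "j < r" for j
    using roots_ge a y[OF that] by (intro S_pos) force+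
  have Sx: "0 < S x (y j)" if "j < r" for j
  proof (rule S_pos)
    show "x < c" if "c \<in> R" for c using Min_R_le[OF that] xM by simp
    show "y j < c" if "c \<in> R" for c using roots_ge[OF that] y[OF \<open>j < r\<close>] by simp
  qed
  define K where "K = (if x \<le> 0 then 1 else Min R / (Min R - x))"
  have e: "\<bar>e j\<bar> \<le> K" if j: "j < r" for j
  proof -
    have "S x (y j) \<le> K * S 0 (y j)"
      unfolding K_def using S_le_nonpos[OF a y[OF j], of x] S_le_nonneg[OF a y[OF j] _ xM] by auto
    then show ?thesis unfolding e_def using S0[OF j] Sx[OF j] by (simp add: field_simps)
  qed
  \<comment> \<open>For positive \<open>x\<close> this is the bound on \<open>x\<close>, rearranged
    to \<open>s * Min R < Min R - x\<close>.\<close>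
  have sK: "s * K < 1"
  proof (cases "x \<le> 0")
    case False
    have "s * Min R < Min R - x" using x unfolding s_def[symmetric] by (simp add: algebra_simps)
    then show ?thesis unfolding K_def using False xM by (simp add: field_simps)
  qed (use s in \<open>simp add: K_def s_def\<close>)
  have "\<bar>\<Sum>j<r. u j * e j\<bar> \<le> (\<Sum>j<r. \<bar>u j\<bar> * K)"
    by (rule order_trans[OF sum_abs sum_mono]) (use e in \<open>auto simp: abs_mult intro!: mult_left_mono\<close>)
  also have "\<dots> = s * K" unfolding s_def by (simp add: sum_distrib_right)
  finally have lt: "1 - (\<Sum>j<r. u j * e j) \<noteq> 0" using sK by linarith
  have "poly (kern (y j)) x / poly (kern (y j)) 0 = poly ppi x / poly ppi 0 * e j" if "j < r" for j
    using nR yR[OF that] unfolding e_def poly_kern[OF nR(1) yR[OF that]] poly_kern[OF nR(2) yR[OF that]]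
    by (auto simp: R_def)
  then have "(\<Sum>j<r. u j * (poly (kern (y j)) x / poly (kern (y j)) 0))
      = poly ppi x / poly ppi 0 * (\<Sum>j<r. u j * e j)"
    unfolding sum_distrib_left by (intro sum.cong) auto
  then have "poly (varsigma m lam b n) x - (\<Sum>j<r. u j * (poly (kern (y j)) x / poly (kern (y j)) 0))
      = poly ppi x / poly ppi 0 * (1 - (\<Sum>j<r. u j * e j))"
    unfolding poly_varsigma by (simp only: right_diff_distrib mult_1_right)
  with lt nR show ?thesis by (simp add: R_def)
qed

section \<open>The linear system for \<sigma>\<close>

text \<open>The system is read row by row; the bracket on the right is the value at the node of the
  perturbed polynomial, which makes the extra terms of the product with a tilde cancel
  later.\<close>

lemma
  fixes dt :: nat
  assumes a: "0 < a" and y: "\<And>j. j < dt - m \<Longrightarrow> lam (m + 1 + j) < a"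
  shows dim_sigma_vec: "dim_vec (sigma_vec m dt lam b n) = dt - m"
    and sigma_vec_equation: "i < dt - m \<Longrightarrow>
      sigma_vec m dt lam b n $ i / poly (kern (lam (m + 1 + i))) 0
      = (b (m + 1 + i))\<^sup>2 * (poly (varsigma m lam b n) (lam (m + 1 + i))
        - (\<Sum>j<dt - m. sigma_vec m dt lam b n $ j * poly (xi_poly m lam b (n - 1) (m + 1 + j)) (lam (m + 1 + i))))"
proof -
  define r where "r = dt - m"
  define k where "k j = kern (lam (m + 1 + j))" for j
  define B where "B = mat_diag r (\<lambda>i. b (m + 1 + i))"
  define C where "C = mat r r (\<lambda>(i, j). poly (xi_poly m lam b (n - 1) (m + 1 + j)) (lam (m + 1 + i)))"
  define D where "D = mat_diag r (\<lambda>j. (pnorm m lam b (xi_poly m lam b (n - 1) (m + 1 + j)))\<^sup>2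
                              / poly (xi_poly m lam b (n - 1) (m + 1 + j)) (lam (m + 1 + j)))"
  define w where "w = vec r (\<lambda>i. poly (varsigma m lam b n) (lam (m + 1 + i)))"
  define M where "M = D + (B ^\<^sub>m 2) * C"
  define \<sigma> where "\<sigma> = sigma_vec m dt lam b n"
  have \<sigma>: "\<sigma> = the (mat_inverse M) *\<^sub>v ((B ^\<^sub>m 2) *\<^sub>v w)"
    unfolding \<sigma>_def sigma_vec_def M_def B_def C_def D_def w_def r_def Let_def by simp
  have k0: "poly (k j) 0 \<noteq> 0" if "j < r" for j
    unfolding k_def using kern_at_0_nonzero[OF a y] that unfolding r_def by blast
  have xi: "xi_poly m lam b (n - 1) (m + 1 + j) = Polynomial.smult (1 / poly (k j) 0) (k j)" for j
    unfolding k_def by (rule xi_poly_eq)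
  \<comment> \<open>By the reproducing property, the squared norm of \<open>k j\<close> is its value
    at its own node, so the quotient collapses to the normalizing factor.\<close>
  have D: "D = mat_diag r (\<lambda>j. 1 / poly (k j) 0)"
  proof -
    have "(pnorm m lam b (xi_poly m lam b (n - 1) (m + 1 + j)))\<^sup>2
        / poly (xi_poly m lam b (n - 1) (m + 1 + j)) (lam (m + 1 + j)) = 1 / poly (k j) 0" if "j < r" for j
      using k0[OF that] poly_kern_diag_pos[of "lam (m + 1 + j)"] ip_kern[OF degree_kern, of "lam (m + 1 + j)"]
      unfolding xi pnorm_power2 ip_linear_left ip_linear_right k_def by (simp add: field_simps)
    then show ?thesis unfolding D_def mat_diag_def by (intro cong_mat) auto
  qed
  have B2: "B ^\<^sub>m 2 = mat_diag r (\<lambda>i. (b (m + 1 + i))\<^sup>2)" unfolding B_def mat_diag_pow ..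
  have carr: "M \<in> carrier_mat r r" "C \<in> carrier_mat r r" "B ^\<^sub>m 2 \<in> carrier_mat r r"
      "D \<in> carrier_mat r r" "w \<in> carrier_vec r"
    unfolding M_def C_def B2 D w_def by (auto intro!: add_carrier_mat mult_carrier_mat)
  have Mv: "(M *\<^sub>v v) $ i = v $ i / poly (k i) 0
      + (b (m + 1 + i))\<^sup>2 * (\<Sum>j<r. poly (xi_poly m lam b (n - 1) (m + 1 + j)) (lam (m + 1 + i)) * v $ j)"
    if v: "v \<in> carrier_vec r" and i: "i < r" for v i
  proof -
    have Cv: "C *\<^sub>v v \<in> carrier_vec r" using carr v by (auto intro: mult_mat_vec_carrier)
    have "M *\<^sub>v v = D *\<^sub>v v + (B ^\<^sub>m 2) *\<^sub>v (C *\<^sub>v v)"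
      unfolding M_def using carr v
      by (simp add: add_mult_distrib_mat_vec[where nr = r and nc = r] assoc_mult_mat_vec[where n\<^sub>3 = r])
    then show ?thesis using i v unfolding D B2 mat_diag_mult_vec[OF v] mat_diag_mult_vec[OF Cv]
      by (simp add: C_def scalar_prod_def atLeast0LessThan)
  qed
  have "det M \<noteq> 0"
  proof
    assume "det M = 0"
    then obtain v where v: "v \<in> carrier_vec r" "v \<noteq> 0\<^sub>v r" "M *\<^sub>v v = 0\<^sub>v r"
      using det_0_iff_vec_prod_zero_field[OF carr(1)] by auto
    \<comment> \<open>Dividing by the values at 0 turns the normalized kernels in \<open>C\<close>
      into plain ones.\<close>
    have "v $ i / poly (k i) 0 = 0" if i: "i < r" for i
    proof (rule kern_gram_definite[where u = "\<lambda>i. v $ i / poly (k i) 0" and r = r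
          and y = "\<lambda>i. lam (m + 1 + i)" and \<beta> = "\<lambda>i. b (m + 1 + i)", OF _ i])
      fix i assume i: "i < r"
      have "(M *\<^sub>v v) $ i = 0" using v(3) i by simp
      then show "v $ i / poly (k i) 0 + (b (m + 1 + i))\<^sup>2 *
          (\<Sum>j<r. poly (kern (lam (m + 1 + j))) (lam (m + 1 + i)) * (v $ j / poly (k j) 0)) = 0"
        unfolding Mv[OF v(1) i] xi by (simp add: k_def)
    qed
    then have "v = 0\<^sub>v r" using v(1) k0 by (intro eq_vecI) auto
    with v(2) show False by simp
  qed
  then obtain V where V: "mat_inverse M = Some V"
    using mat_inverse(1)[OF carr(1), of "()"] det_non_zero_imp_unit[OF carr(1), of "()"] by blast
  then have V': "M * V = 1\<^sub>m r" "V \<in> carrier_mat r r" using mat_inverse(2)[OF carr(1)] by auto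
  have w2: "(B ^\<^sub>m 2) *\<^sub>v w \<in> carrier_vec r" using carr by (auto intro: mult_mat_vec_carrier)
  have \<sigma>c: "\<sigma> \<in> carrier_vec r" unfolding \<sigma> V using V' w2 by (auto intro: mult_mat_vec_carrier)
  have M\<sigma>: "M *\<^sub>v \<sigma> = (B ^\<^sub>m 2) *\<^sub>v w"
    unfolding \<sigma> V using V' w2 by (simp add: assoc_mult_mat_vec[OF carr(1) V'(2) w2, symmetric])
  show "dim_vec (sigma_vec m dt lam b n) = dt - m"
    using \<sigma>c unfolding \<sigma>_def r_def by auto
  assume "i < dt - m"
  then have i: "i < r" unfolding r_def .
  from arg_cong[OF M\<sigma>, of "\<lambda>v. v $ i"] have
    "\<sigma> $ i / poly (k i) 0
      + (b (m + 1 + i))\<^sup>2 * (\<Sum>j<r. poly (xi_poly m lam b (n - 1) (m + 1 + j)) (lam (m + 1 + i)) * \<sigma> $ j)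
      = (b (m + 1 + i))\<^sup>2 * poly (varsigma m lam b n) (lam (m + 1 + i))"
    unfolding Mv[OF \<sigma>c i] B2 mat_diag_mult_vec[OF carr(5)] using i by (simp add: w_def)
  then show "sigma_vec m dt lam b n $ i / poly (kern (lam (m + 1 + i))) 0
      = (b (m + 1 + i))\<^sup>2 * (poly (varsigma m lam b n) (lam (m + 1 + i))
        - (\<Sum>j<dt - m. sigma_vec m dt lam b n $ j * poly (xi_poly m lam b (n - 1) (m + 1 + j)) (lam (m + 1 + i))))"
    unfolding \<sigma>_def[symmetric] r_def[symmetric] k_def by (simp add: algebra_simps)
qed

end

section \<open>Passage to the product with a tilde\<close>

lemma ip_mono: "m \<le> m' \<Longrightarrow> ip m lam b p p \<le> ip m' lam b p p"
  unfolding ip_def by (intro sum_mono2) (auto simp: mult.assoc)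

lemma ip_split:
  "ip (m + r) lam b p q
    = ip m lam b p q + (\<Sum>i<r. (b (m + 1 + i))\<^sup>2 * poly p (lam (m + 1 + i)) * poly q (lam (m + 1 + i)))"
  unfolding ip_def by (induction r) auto

theorem corollary3p5:
  fixes d dt n :: nat and lam b :: "nat \<Rightarrow> real" and s gam :: real
  assumes "0 < d" and "d \<le> dt"
    and "\<forall>i j. 1 \<le> i \<and> i \<le> j \<and> j \<le> dt \<longrightarrow> lam j \<le> lam i"
    and "0 < lam d"
    and "d < dt \<longrightarrow> lam (d + 1) < lam d"
    and "1 \<le> n" and "n \<le> grade d lam b"
    and "gam = smallest_root (pi_poly d lam b n)"
    and "s = l1_norm (sigma_vec d dt lam b n)"
    and "s < 1"
  shows "\<forall>x. poly (pi_poly dt lam b n) x = 0 \<longrightarrow> (1 - s) * gam \<le> x \<and> 0 < x"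
proof -
  \<comment> \<open>By monotonicity, \<open>lam d\<close> is the smallest of the first
    \<open>d\<close> nodes.\<close>
  interpret definite_ip_right d lam b n "lam d"
    using assms(2,3,6,7) ip_positive_definite_below_grade by unfold_locales auto
  have dpos: "p = 0" if "degree p < n" "ip dt lam b p p = 0" for p
    using definite[OF that(1)] ip_mono[OF assms(2), of lam b p] that(2) ip_nonneg[of d lam b p] by simp
  interpret tilde: definite_ip dt lam b n
    using dpos n_pos by unfold_locales auto
  define r where "r = dt - d"
  define y where "y j = lam (d + 1 + j)" for j
  have dt: "dt = d + r" using assms(2) unfolding r_def by simp
  have y: "y j < lam d" if "j < r" for j
  proof -
    have "lam (d + 1 + j) \<le> lam (d + 1)" using assms(3) that unfolding dt by auto
    then show ?thesis using assms(5) that unfolding y_def dt by auto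
  qed
  define \<sigma> where "\<sigma> j = sigma_vec d dt lam b n $ j" for j
  define xi where "xi j = xi_poly d lam b (n - 1) (d + 1 + j)" for j
  have xi: "xi j = Polynomial.smult (1 / poly (kern (y j)) 0) (kern (y j))" for j
    unfolding xi_def y_def by (rule xi_poly_eq)
  have ylt: "\<And>j. j < dt - d \<Longrightarrow> lam (d + 1 + j) < lam d"
    using y unfolding y_def r_def .
  have s: "s = (\<Sum>j<r. \<bar>\<sigma> j\<bar>)"
    using dim_sigma_vec[OF assms(4), of dt] ylt
    unfolding assms(9) l1_norm_def r_def \<sigma>_def by simp
  have gam: "gam = Min R" unfolding assms(8) smallest_root_def R_def ..
  define P where "P = varsigma d lam b n - (\<Sum>j<r. Polynomial.smult (\<sigma> j) (xi j))"
  have \<sigma>: "\<sigma> i / poly (kern (y i)) 0 = (b (d + 1 + i))\<^sup>2 * poly P (y i)" if "i < r" for i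
    using sigma_vec_equation[OF assms(4), of dt i] ylt that
    unfolding P_def r_def \<sigma>_def y_def xi_def by (simp add: poly_sum)
  have p0: "poly ppi 0 \<noteq> 0" using roots_ge[of 0] assms(4) unfolding R_def by auto
  define X where "X = (\<Sum>j<r. Polynomial.smult (\<sigma> j) (xi j))"
  have dX: "degree X < n" unfolding X_def xi
    by (rule degree_sum_less) (use degree_kern n_pos in \<open>auto intro: le_less_trans[OF degree_smult_le]\<close>)
  \<comment> \<open>Undoing the normalization at 0 makes \<open>P\<close> monic, since
    \<open>X\<close> has degree less than \<open>n\<close>.\<close>
  have P: "Polynomial.smult (poly ppi 0) P = ppi - Polynomial.smult (poly ppi 0) X"
    unfolding P_def X_def[symmetric] varsigma_def using p0 by (simp add: smult_diff_right)
  have "pi_poly dt lam b n = Polynomial.smult (poly ppi 0) P"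
  proof (rule tilde.pi_poly_eqI)
    show "degree (Polynomial.smult (poly ppi 0) P) \<le> n"
      unfolding P using dX degree_pi_poly by (intro degree_diff_le) auto
    show "poly.coeff (Polynomial.smult (poly ppi 0) P) n = 1"
      unfolding P using coeff_pi_poly coeff_eq_0[OF dX] by simp
  next
    fix q :: "real poly" assume q: "degree q < n"
    \<comment> \<open>The \<open>varsigma\<close> part is orthogonal to \<open>q\<close>, and each
      kernel evaluates \<open>q\<close> at its node.\<close>
    have "ip d lam b P q = - (\<Sum>j<r. \<sigma> j / poly (kern (y j)) 0 * poly q (y j))"
      unfolding P_def varsigma_def xi
      by (simp add: ip_linear_left ip_sum_left ip_pi_poly[OF q] ip_kern[OF q])
    also have "\<dots> = - (\<Sum>j<r. (b (d + 1 + j))\<^sup>2 * poly P (y j) * poly q (y j))"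
      using \<sigma> by simp
    \<comment> \<open>The terms of the nodes beyond \<open>d\<close> cancel this sum
      exactly.\<close>
    finally have "ip dt lam b P q = 0" unfolding dt ip_split y_def by simp
    then show "ip dt lam b (Polynomial.smult (poly ppi 0) P) q = 0" by (simp add: ip_linear_left)
  qed
  then have root: "poly P x = 0" if "poly (pi_poly dt lam b n) x = 0" for x
    using that p0 by simp
  have "(1 - s) * gam \<le> x" if "poly (pi_poly dt lam b n) x = 0" for x
  proof (rule ccontr)
    assume "\<not> (1 - s) * gam \<le> x"
    then have "poly P x \<noteq> 0"
      using varsigma_minus_kernels_nonzero[where u = \<sigma> and y = y and r = r and x = x, OF assms(4) y] assms(10)
      unfolding s gam P_def xi by (simp add: poly_sum)
    with root[OF that] show False by simp
  qed
  moreover have "0 < (1 - s) * gam"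
    using assms(4,10) Min_R_ge unfolding gam by (intro mult_pos_pos) auto
  ultimately show ?thesis by force
qed

end
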